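(* $\mathcal A_3 = \mathcal A_5 = \mathcal A_7 = \mathcal A_8 = \mathcal A_{10}$.
   Context: An $\mathcal I$-zroupoid is an algebra $\langle A,\to,0\rangle$ ($\to$ binary, $0$ constant) satisfying $(x \to y) \to z \approx [(z' \to x) \to (y \to z)']'$ and $0''\approx 0$, where $x' := x \to 0$; $\mathcal I$ is the variety of $\mathcal I$-zroupoids. $\mathcal A_3, \mathcal A_5, \mathcal A_7, \mathcal A_8, \mathcal A_{10}$ are the subvarieties of $\mathcal I$ defined respectively by the identities (A3) $x \to (y \to z) \approx (x \to z) \to y$; (A5) $x \to (y \to z) \approx (y \to x) \to z$; (A7) $x \to (y \to z) \approx (y \to z) \to x$; (A8) $x \to (y \to z) \approx (z \to x) \to y$; (A10) $x \to (y \to z) \approx (z \to y) \to x$. *)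

theory Defs
  imports Main
begin

record 'a zroupoid =
  carrier :: "'a set"
  arr :: "'a \<Rightarrow> 'a \<Rightarrow> 'a"  (infixr \<open>\<rightarrow>\<index>\<close> 65)
  zer :: 'a  (\<open>\<zero>\<index>\<close>)

definition prm :: "('a, 'm) zroupoid_scheme \<Rightarrow> 'a \<Rightarrow> 'a"  (\<open>prime\<index> _\<close> [81] 80)
  where "prime\<^bsub>A\<^esub> x = x \<rightarrow>\<^bsub>A\<^esub> \<zero>\<^bsub>A\<^esub>"

locale I_zroupoid =
  fixes A :: "('a, 'm) zroupoid_scheme" (structure)
  assumes arr_closed: "\<lbrakk>x \<in> carrier A; y \<in> carrier A\<rbrakk> \<Longrightarrow> x \<rightarrow> y \<in> carrier A"
    and zer_closed: "\<zero> \<in> carrier A"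
    and I: "\<lbrakk>x \<in> carrier A; y \<in> carrier A; z \<in> carrier A\<rbrakk> \<Longrightarrow>
      (x \<rightarrow> y) \<rightarrow> z = prime ((prime z \<rightarrow> x) \<rightarrow> prime (y \<rightarrow> z))"
    and I0: "prime (prime \<zero>) = \<zero>"

text \<open>
  A variety is a proper class of algebras; here each one is rendered as the set of its members
  whose universe is a subset of an arbitrary type \<open>'a\<close>.  Algebras are nonempty
  because they contain the constant.
\<close>

definition variety_I :: "'a zroupoid set"
  where "variety_I = {A. I_zroupoid A}"

definition variety_A3 :: "'a zroupoid set"
  where "variety_A3 = {A \<in> variety_I. \<forall>x\<in>carrier A. \<forall>y\<in>carrier A. \<forall>z\<in>carrier A.
    x \<rightarrow>\<^bsub>A\<^esub> (y \<rightarrow>\<^bsub>A\<^esub> z) = (x \<rightarrow>\<^bsub>A\<^esub> z) \<rightarrow>\<^bsub>A\<^esub> y}"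

definition variety_A5 :: "'a zroupoid set"
  where "variety_A5 = {A \<in> variety_I. \<forall>x\<in>carrier A. \<forall>y\<in>carrier A. \<forall>z\<in>carrier A.
    x \<rightarrow>\<^bsub>A\<^esub> (y \<rightarrow>\<^bsub>A\<^esub> z) = (y \<rightarrow>\<^bsub>A\<^esub> x) \<rightarrow>\<^bsub>A\<^esub> z}"

definition variety_A7 :: "'a zroupoid set"
  where "variety_A7 = {A \<in> variety_I. \<forall>x\<in>carrier A. \<forall>y\<in>carrier A. \<forall>z\<in>carrier A.
    x \<rightarrow>\<^bsub>A\<^esub> (y \<rightarrow>\<^bsub>A\<^esub> z) = (y \<rightarrow>\<^bsub>A\<^esub> z) \<rightarrow>\<^bsub>A\<^esub> x}"

definition variety_A8 :: "'a zroupoid set"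
  where "variety_A8 = {A \<in> variety_I. \<forall>x\<in>carrier A. \<forall>y\<in>carrier A. \<forall>z\<in>carrier A.
    x \<rightarrow>\<^bsub>A\<^esub> (y \<rightarrow>\<^bsub>A\<^esub> z) = (z \<rightarrow>\<^bsub>A\<^esub> x) \<rightarrow>\<^bsub>A\<^esub> y}"

definition variety_A10 :: "'a zroupoid set"
  where "variety_A10 = {A \<in> variety_I. \<forall>x\<in>carrier A. \<forall>y\<in>carrier A. \<forall>z\<in>carrier A.
    x \<rightarrow>\<^bsub>A\<^esub> (y \<rightarrow>\<^bsub>A\<^esub> z) = (z \<rightarrow>\<^bsub>A\<^esub> y) \<rightarrow>\<^bsub>A\<^esub> x}"

end

theory Submission
  imports Defs
begin

text \<open>
  Each of the five identities, together with the zroupoid axioms, forces \<open>x \<rightarrow> (y \<rightarrow> z)\<close> to be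
  invariant under all permutations of its arguments and equal to \<open>(x \<rightarrow> y) \<rightarrow> z\<close>, although
  \<open>\<rightarrow>\<close> itself need not be commutative.  The constant is the lever: it is idempotent, it commutes
  with every element, and it is absorbed by products of three factors, so that a third factor can
  be moved past it.  The inclusions A3 in A5 in A10 in A7 in A3 and A3 in A8 in A7 close the cycle.
\<close>

text \<open>An algebra on a whole type needs no membership premises, so the arguments below are
  unconditional equations. Prime is spelled out as multiplication by \<open>e\<close> on the
  right.\<close>

locale total_I =
  fixes mult :: "'a \<Rightarrow> 'a \<Rightarrow> 'a"  (infixr \<open>\<cdot>\<close> 70)
    and e :: 'a
  assumes I: "(x \<cdot> y) \<cdot> z = (((z \<cdot> e) \<cdot> x) \<cdot> ((y \<cdot> z) \<cdot> e)) \<cdot> e"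
    and I0: "(e \<cdot> e) \<cdot> e = e"
begin

section \<open>Consequences of the identities in a total algebra\<close>

lemma
  assumes "\<And>x y z. x \<cdot> y \<cdot> z = (x \<cdot> z) \<cdot> y"
  shows A3_inner_comm: "x \<cdot> y \<cdot> z = x \<cdot> z \<cdot> y"
    and A3_outer_comm: "x \<cdot> y \<cdot> z = (y \<cdot> z) \<cdot> x"
proof -
  have e_e_e: "e \<cdot> e \<cdot> e = e"
    by (metis I0 assms)
  have e_pow4: "e \<cdot> e \<cdot> e \<cdot> e \<cdot> x = x \<cdot> e" for x
    by (metis I assms e_e_e)
  \<comment> \<open>At \<open>x = e\<close> the left side of \<open>e_pow4\<close> collapses to
    \<open>e\<close> by \<open>e_e_e\<close>.\<close>
  have e_idem: "e \<cdot> e = e"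
    by (metis I0 e_e_e e_pow4)
  have e_right_idem: "(x \<cdot> e) \<cdot> e = x \<cdot> e" for x
    by (metis assms e_idem)
  have e_comm: "e \<cdot> x = x \<cdot> e" for x
    by (metis assms e_pow4 e_idem)
  have e_left_idem: "e \<cdot> e \<cdot> x = e \<cdot> x" for x
    by (metis e_right_idem e_comm)
  \<comment> \<open>A3 turns the product into \<open>(x \<cdot> z) \<cdot> y\<close>, which
    \<open>I\<close> writes as a multiple of \<open>e\<close>; a further \<open>e\<close> changes
    nothing.\<close>
  have e_absorb: "e \<cdot> x \<cdot> y \<cdot> z = x \<cdot> y \<cdot> z" for x y z
    by (metis I assms e_right_idem e_comm e_left_idem)
  \<comment> \<open>In juxtaposition, A3 gives
    \<open>e((xz)y) = (ey)(xz) = ((ey)z)x = (e(zy))x = e(x(zy))\<close>; then \<open>e\<close> is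
    absorbed at both ends.\<close>
  show inner_comm: "x \<cdot> y \<cdot> z = x \<cdot> z \<cdot> y" for x y z
    by (metis assms e_absorb)
  \<comment> \<open>Behind a leading \<open>e\<close>, \<open>inner_comm\<close> exchanges
    \<open>x\<close> with \<open>y \<cdot> z\<close>.\<close>
  show "x \<cdot> y \<cdot> z = (y \<cdot> z) \<cdot> x"
    by (metis assms e_absorb inner_comm)
qed

lemma A3_imp_A5:
  assumes "\<And>x y z. x \<cdot> y \<cdot> z = (x \<cdot> z) \<cdot> y"
  shows "x \<cdot> y \<cdot> z = (y \<cdot> x) \<cdot> z"
  by (metis assms A3_inner_comm[OF assms] A3_outer_comm[OF assms])

lemma A3_imp_A8:
  assumes "\<And>x y z. x \<cdot> y \<cdot> z = (x \<cdot> z) \<cdot> y"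
  shows "x \<cdot> y \<cdot> z = (z \<cdot> x) \<cdot> y"
  by (metis assms A3_inner_comm[OF assms] A3_outer_comm[OF assms])

lemma A5_imp_A10:
  assumes "\<And>x y z. x \<cdot> y \<cdot> z = (y \<cdot> x) \<cdot> z"
  shows "x \<cdot> y \<cdot> z = (z \<cdot> y) \<cdot> x"
proof -
  have swap_e: "x \<cdot> y \<cdot> e = y \<cdot> x \<cdot> e" for x y
    by (metis I0 I assms)
  have e_right_idem: "(x \<cdot> e) \<cdot> e = x \<cdot> e" for x
    by (metis I0 I assms swap_e)
  have e_idem: "e \<cdot> e = e"
    by (metis I0 e_right_idem)
  have e_comm: "e \<cdot> x = x \<cdot> e" for x
    by (metis I assms e_idem)
  have e_left_idem: "e \<cdot> e \<cdot> x = e \<cdot> x" for x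
    by (metis assms e_idem)
  have e_absorb: "e \<cdot> x \<cdot> y \<cdot> z = x \<cdot> y \<cdot> z" for x y z
    by (metis I assms swap_e e_comm e_left_idem)
  have e_absorb_right: "(x \<cdot> y \<cdot> z) \<cdot> e = x \<cdot> y \<cdot> z" for x y z
    by (metis assms swap_e e_comm e_absorb)
  have inner_e: "x \<cdot> y \<cdot> z \<cdot> e = x \<cdot> y \<cdot> z" for x y z
    by (metis assms swap_e e_absorb_right)
  \<comment> \<open>\<open>inner_e\<close> inserts an innermost \<open>e\<close>, next to which
    \<open>swap_e\<close> exchanges \<open>y\<close> and \<open>z\<close>.\<close>
  have inner_comm: "x \<cdot> y \<cdot> z = x \<cdot> z \<cdot> y" for x y z
    by (metis swap_e inner_e)
  \<comment> \<open>\<open>(yz)x = z(yx) = z(y(xe)) = (yz)(xe) = (x(yz))e = x(yz)\<close>.\<close>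
  have outer_comm: "x \<cdot> y \<cdot> z = (y \<cdot> z) \<cdot> x" for x y z
    by (metis assms e_absorb_right inner_e)
  show ?thesis
    by (metis assms inner_comm outer_comm)
qed

lemma A10_imp_A7:
  assumes "\<And>x y z. x \<cdot> y \<cdot> z = (z \<cdot> y) \<cdot> x"
  shows "x \<cdot> y \<cdot> z = (y \<cdot> z) \<cdot> x"
proof -
  have e_e_e: "e \<cdot> e \<cdot> e = e"
    by (metis I0 assms)
  \<comment> \<open>Both nestings of three \<open>e\<close> equal \<open>e\<close>, so A10 carries
    it across \<open>x\<close>.\<close>
  have e_comm: "e \<cdot> x = x \<cdot> e" for x
    by (metis assms e_e_e)
  have e_idem: "e \<cdot> e = e"
    by (metis I e_e_e e_comm)
  have e_left_idem: "e \<cdot> e \<cdot> x = e \<cdot> x" for x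
    using assms e_comm e_comm[of "_ \<cdot> _", symmetric] e_idem I by metis
  have swap_e: "x \<cdot> y \<cdot> e = y \<cdot> x \<cdot> e" for x y
    by (metis I assms e_comm e_idem e_left_idem)
  have e_right_idem: "(x \<cdot> e) \<cdot> e = x \<cdot> e" for x
    by (metis e_comm e_left_idem)
  have e_swap: "e \<cdot> x \<cdot> y \<cdot> e = e \<cdot> y \<cdot> x" for x y
    by (metis I assms e_comm e_idem e_left_idem swap_e)
  \<comment> \<open>This is \<open>I\<close> with the final \<open>e\<close> moved to the front, the
    two factors exchanged by \<open>e_swap\<close>, and \<open>(ye)z\<close> turned into
    \<open>y(ze)\<close>.\<close>
  have e_unfold: "e \<cdot> (x \<cdot> y) \<cdot> y \<cdot> z \<cdot> e = (z \<cdot> x) \<cdot> y" for x y z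
    by (metis I assms e_comm e_idem e_left_idem swap_e e_swap)
  have e_assoc: "(x \<cdot> e) \<cdot> y = x \<cdot> y \<cdot> e" for x y
    by (metis assms e_comm swap_e)
  have e_collapse: "e \<cdot> x \<cdot> y \<cdot> x = y \<cdot> x \<cdot> e" for x y
    by (metis assms e_comm e_idem e_left_idem swap_e e_swap e_unfold e_assoc)
  have e_push: "e \<cdot> x \<cdot> y = y \<cdot> x \<cdot> e" for x y
    by (metis assms e_comm e_idem e_left_idem e_swap e_unfold e_collapse)
  \<comment> \<open>By \<open>e_unfold\<close> the product is already \<open>e\<close> times
    something, so \<open>e_left_idem\<close> applies.\<close>
  have e_absorb_left: "e \<cdot> (x \<cdot> y) \<cdot> z = (x \<cdot> y) \<cdot> z" for x y z
    by (metis assms e_comm e_left_idem swap_e e_right_idem e_swap e_unfold e_collapse e_push)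
  \<comment> \<open>\<open>(zy)x = e((zy)x) = (x(zy))e = e((yz)x) = (yz)x\<close>.\<close>
  show ?thesis
    by (metis assms e_comm e_absorb_left)
qed

lemma A8_imp_A7:
  assumes "\<And>x y z. x \<cdot> y \<cdot> z = (z \<cdot> x) \<cdot> y"
  shows "x \<cdot> y \<cdot> z = (y \<cdot> z) \<cdot> x"
proof -
  have e_comm: "e \<cdot> x = x \<cdot> e" for x
    by (metis I0 I assms)
  have e_idem: "e \<cdot> e = e"
    by (metis I0 I assms e_comm)
  have e_left_idem: "e \<cdot> e \<cdot> x = e \<cdot> x" for x
    by (metis assms e_comm e_idem)
  have e_right_idem: "(x \<cdot> e) \<cdot> e = x \<cdot> e" for x
    by (metis e_comm e_left_idem)
  have swap_e: "x \<cdot> y \<cdot> e = y \<cdot> x \<cdot> e" for x y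
    by (metis assms e_comm e_left_idem e_right_idem)
  have e_absorb: "e \<cdot> x \<cdot> y \<cdot> z = x \<cdot> y \<cdot> z" for x y z
    by (metis I assms e_comm e_idem swap_e)
  have e_absorb_right: "(x \<cdot> y \<cdot> z) \<cdot> e = x \<cdot> y \<cdot> z" for x y z
    by (metis I assms e_comm e_idem swap_e e_absorb)
  have inner_e: "x \<cdot> y \<cdot> z \<cdot> e = x \<cdot> y \<cdot> z" for x y z
    by (metis I assms e_comm e_idem swap_e e_absorb e_absorb_right)
  \<comment> \<open>\<open>(yz)x = z(xy) = z(x(ye)) = z((ex)y) = (yz)(ex) = (x(yz))e =
    x(yz)\<close>.\<close>
  show ?thesis
    by (metis assms e_absorb_right inner_e)
qed

lemma A7_imp_A3:
  assumes "\<And>x y z. x \<cdot> y \<cdot> z = (y \<cdot> z) \<cdot> x"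
  shows "x \<cdot> y \<cdot> z = (x \<cdot> z) \<cdot> y"
proof -
  \<comment> \<open>By \<open>I0\<close> the constant is itself a product, so A7 applies to
    it.\<close>
  have e_comm: "e \<cdot> x = x \<cdot> e" for x
    by (metis I0 assms)
  have e_idem: "e \<cdot> e = e"
    by (metis I0 I e_comm)
  have unfold: "e \<cdot> ((x \<cdot> e) \<cdot> y) \<cdot> e \<cdot> z \<cdot> x = (y \<cdot> z) \<cdot> x" for x y z
    by (metis I e_comm)
  have e_cube: "e \<cdot> e \<cdot> e \<cdot> x = e \<cdot> x \<cdot> e" for x
    by (metis unfold e_comm e_idem)
  have e_product: "e \<cdot> (e \<cdot> x) \<cdot> e \<cdot> e \<cdot> y = e \<cdot> x \<cdot> y" for x y
    by (metis unfold e_comm e_idem)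
  have e_shift: "e \<cdot> (e \<cdot> e \<cdot> x) \<cdot> y = e \<cdot> (x \<cdot> e) \<cdot> y" for x y
    by (metis e_product e_cube)
  have e_fold: "e \<cdot> (x \<cdot> e) \<cdot> e \<cdot> y = e \<cdot> y \<cdot> x" for x y
    by (metis assms e_product e_shift)
  \<comment> \<open>The next facts strip the inner \<open>e\<close> factors from
    \<open>unfold\<close>, which leaves \<open>distrib\<close>.\<close>
  have inner_drop: "(x \<cdot> e \<cdot> y) \<cdot> z = (x \<cdot> y) \<cdot> z" for x y z
    by (metis unfold assms e_comm e_fold e_product e_shift)
  have outer_drop: "x \<cdot> y \<cdot> e \<cdot> z = (y \<cdot> z) \<cdot> x" for x y z
    by (metis assms inner_drop)
  have turn: "((x \<cdot> e) \<cdot> y) \<cdot> z = (y \<cdot> x) \<cdot> z" for x y z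
    by (metis assms e_comm inner_drop)
  have distrib: "e \<cdot> (y \<cdot> x) \<cdot> z \<cdot> x = (y \<cdot> z) \<cdot> x" for x y z
    by (metis unfold assms outer_drop turn)
  have e_distrib: "e \<cdot> x \<cdot> y \<cdot> x = (y \<cdot> e) \<cdot> x" for x y
    by (metis distrib assms outer_drop e_comm)
  \<comment> \<open>The case \<open>y = e\<close> of \<open>e_distrib\<close>.\<close>
  have e_square: "e \<cdot> x \<cdot> x = e \<cdot> x" for x
    by (metis e_distrib outer_drop e_comm e_idem)
  \<comment> \<open>\<open>e(ex) = e((ex)(ex)) = e(xx) = ex\<close>, with \<open>e_square\<close> at
    both ends.\<close>
  have e_left_idem: "e \<cdot> e \<cdot> x = e \<cdot> x" for x
    by (metis assms e_comm e_square inner_drop)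
  have swap_e: "x \<cdot> y \<cdot> e = y \<cdot> x \<cdot> e" for x y
    by (metis I assms e_comm e_idem e_left_idem)
  have e_right_idem: "(x \<cdot> e) \<cdot> e = x \<cdot> e" for x
    by (metis e_comm e_left_idem)
  have e_absorb: "e \<cdot> x \<cdot> y \<cdot> z = x \<cdot> y \<cdot> z" for x y z
    by (metis I assms e_comm e_idem e_left_idem swap_e e_right_idem)
  have inner_e: "x \<cdot> y \<cdot> z \<cdot> e = x \<cdot> y \<cdot> z" for x y z
    by (metis I assms e_comm e_idem swap_e e_right_idem e_absorb)
  have inner_comm: "x \<cdot> y \<cdot> z = x \<cdot> z \<cdot> y" for x y z
    by (metis swap_e inner_e)
  show ?thesis
    by (metis I assms e_comm e_idem e_left_idem swap_e e_absorb inner_e inner_comm)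
qed

end

section \<open>Transfer to arbitrary carriers\<close>

text \<open>
  Every identity involved equates two proper products, so it survives replacing each argument by
  its image under a retraction of the whole type onto the carrier.  The operation below is
  therefore total and satisfies the same identities as \<open>A\<close>.
\<close>

definition retract :: "('a, 'm) zroupoid_scheme \<Rightarrow> 'a \<Rightarrow> 'a"
  where "retract A x = (if x \<in> carrier A then x else \<zero>\<^bsub>A\<^esub>)"

definition extend :: "('a, 'm) zroupoid_scheme \<Rightarrow> 'a \<Rightarrow> 'a \<Rightarrow> 'a"
  where "extend A x y = retract A x \<rightarrow>\<^bsub>A\<^esub> retract A y"

context I_zroupoid
begin

lemma retract_closed: "retract A x \<in> carrier A"
  by (simp add: retract_def zer_closed)

lemma retract_id: "x \<in> carrier A \<Longrightarrow> retract A x = x"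
  by (simp add: retract_def)

lemmas retract_simps = retract_closed retract_id arr_closed zer_closed

lemma Ball_carrier_iff: "(\<forall>x\<in>carrier A. P x) \<longleftrightarrow> (\<forall>x. P (retract A x))"
  by (metis retract_closed retract_id)

text \<open>The right side of \<open>I0\<close> is no product, but it has no variable to
  retract.\<close>

lemma total_I_extend: "total_I (extend A) \<zero>"
proof
  show "extend A (extend A x y) z = extend A (extend A (extend A (extend A z \<zero>) x)
      (extend A (extend A y z) \<zero>)) \<zero>" for x y z
    using I[OF retract_closed retract_closed retract_closed, of x y z]
    by (simp add: extend_def prm_def retract_simps)
  show "extend A (extend A \<zero> \<zero>) \<zero> = \<zero>"
    using I0 by (simp add: extend_def prm_def retract_simps)
qed

text \<open>The retraction is onto the carrier, so its values can replace the bounded variables; it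
  fixes the inner products, which lie in the carrier.\<close>

lemma A3_iff_extend:
  "(\<forall>x\<in>carrier A. \<forall>y\<in>carrier A. \<forall>z\<in>carrier A. x \<rightarrow> (y \<rightarrow> z) = (x \<rightarrow> z) \<rightarrow> y) \<longleftrightarrow>
    (\<forall>x y z. extend A x (extend A y z) = extend A (extend A x z) y)"
  by (simp add: Ball_carrier_iff extend_def retract_simps)

lemma A5_iff_extend:
  "(\<forall>x\<in>carrier A. \<forall>y\<in>carrier A. \<forall>z\<in>carrier A. x \<rightarrow> (y \<rightarrow> z) = (y \<rightarrow> x) \<rightarrow> z) \<longleftrightarrow>
    (\<forall>x y z. extend A x (extend A y z) = extend A (extend A y x) z)"
  by (simp add: Ball_carrier_iff extend_def retract_simps)

lemma A7_iff_extend: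
  "(\<forall>x\<in>carrier A. \<forall>y\<in>carrier A. \<forall>z\<in>carrier A. x \<rightarrow> (y \<rightarrow> z) = (y \<rightarrow> z) \<rightarrow> x) \<longleftrightarrow>
    (\<forall>x y z. extend A x (extend A y z) = extend A (extend A y z) x)"
  by (simp add: Ball_carrier_iff extend_def retract_simps)

lemma A8_iff_extend:
  "(\<forall>x\<in>carrier A. \<forall>y\<in>carrier A. \<forall>z\<in>carrier A. x \<rightarrow> (y \<rightarrow> z) = (z \<rightarrow> x) \<rightarrow> y) \<longleftrightarrow>
    (\<forall>x y z. extend A x (extend A y z) = extend A (extend A z x) y)"
  by (simp add: Ball_carrier_iff extend_def retract_simps)

lemma A10_iff_extend:
  "(\<forall>x\<in>carrier A. \<forall>y\<in>carrier A. \<forall>z\<in>carrier A. x \<rightarrow> (y \<rightarrow> z) = (z \<rightarrow> y) \<rightarrow> x) \<longleftrightarrow>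
    (\<forall>x y z. extend A x (extend A y z) = extend A (extend A z y) x)"
  by (simp add: Ball_carrier_iff extend_def retract_simps)

end

section \<open>Inclusions among the varieties\<close>

lemma variety_A3_subset_A5: "variety_A3 \<subseteq> variety_A5"
proof
  fix A :: "'a zroupoid"
  assume A: "A \<in> variety_A3"
  then interpret I_zroupoid A
    by (simp add: variety_A3_def variety_I_def)
  interpret total_I "extend A" "\<zero>\<^bsub>A\<^esub>"
    by (fact total_I_extend)
  note A3 = A[unfolded variety_A3_def mem_Collect_eq A3_iff_extend]
  show "A \<in> variety_A5"
    unfolding variety_A5_def mem_Collect_eq A5_iff_extend
    by (intro conjI allI conjunct1[OF A3] A3_imp_A5[OF conjunct2[OF A3, rule_format]])
qed

lemma variety_A3_subset_A8: "variety_A3 \<subseteq> variety_A8"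
proof
  fix A :: "'a zroupoid"
  assume A: "A \<in> variety_A3"
  then interpret I_zroupoid A
    by (simp add: variety_A3_def variety_I_def)
  interpret total_I "extend A" "\<zero>\<^bsub>A\<^esub>"
    by (fact total_I_extend)
  note A3 = A[unfolded variety_A3_def mem_Collect_eq A3_iff_extend]
  show "A \<in> variety_A8"
    unfolding variety_A8_def mem_Collect_eq A8_iff_extend
    by (intro conjI allI conjunct1[OF A3] A3_imp_A8[OF conjunct2[OF A3, rule_format]])
qed

lemma variety_A5_subset_A10: "variety_A5 \<subseteq> variety_A10"
proof
  fix A :: "'a zroupoid"
  assume A: "A \<in> variety_A5"
  then interpret I_zroupoid A
    by (simp add: variety_A5_def variety_I_def)
  interpret total_I "extend A" "\<zero>\<^bsub>A\<^esub>"
    by (fact total_I_extend)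
  note A5 = A[unfolded variety_A5_def mem_Collect_eq A5_iff_extend]
  show "A \<in> variety_A10"
    unfolding variety_A10_def mem_Collect_eq A10_iff_extend
    by (intro conjI allI conjunct1[OF A5] A5_imp_A10[OF conjunct2[OF A5, rule_format]])
qed

lemma variety_A10_subset_A7: "variety_A10 \<subseteq> variety_A7"
proof
  fix A :: "'a zroupoid"
  assume A: "A \<in> variety_A10"
  then interpret I_zroupoid A
    by (simp add: variety_A10_def variety_I_def)
  interpret total_I "extend A" "\<zero>\<^bsub>A\<^esub>"
    by (fact total_I_extend)
  note A10 = A[unfolded variety_A10_def mem_Collect_eq A10_iff_extend]
  show "A \<in> variety_A7"
    unfolding variety_A7_def mem_Collect_eq A7_iff_extend
    by (intro conjI allI conjunct1[OF A10] A10_imp_A7[OF conjunct2[OF A10, rule_format]])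
qed

lemma variety_A8_subset_A7: "variety_A8 \<subseteq> variety_A7"
proof
  fix A :: "'a zroupoid"
  assume A: "A \<in> variety_A8"
  then interpret I_zroupoid A
    by (simp add: variety_A8_def variety_I_def)
  interpret total_I "extend A" "\<zero>\<^bsub>A\<^esub>"
    by (fact total_I_extend)
  note A8 = A[unfolded variety_A8_def mem_Collect_eq A8_iff_extend]
  show "A \<in> variety_A7"
    unfolding variety_A7_def mem_Collect_eq A7_iff_extend
    by (intro conjI allI conjunct1[OF A8] A8_imp_A7[OF conjunct2[OF A8, rule_format]])
qed

lemma variety_A7_subset_A3: "variety_A7 \<subseteq> variety_A3"
proof
  fix A :: "'a zroupoid"
  assume A: "A \<in> variety_A7"
  then interpret I_zroupoid A
    by (simp add: variety_A7_def variety_I_def)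
  interpret total_I "extend A" "\<zero>\<^bsub>A\<^esub>"
    by (fact total_I_extend)
  note A7 = A[unfolded variety_A7_def mem_Collect_eq A7_iff_extend]
  show "A \<in> variety_A3"
    unfolding variety_A3_def mem_Collect_eq A3_iff_extend
    by (intro conjI allI conjunct1[OF A7] A7_imp_A3[OF conjunct2[OF A7, rule_format]])
qed

theorem theorem3p12:
  shows "(variety_A3 :: 'a zroupoid set) = variety_A5
    \<and> (variety_A5 :: 'a zroupoid set) = variety_A7
    \<and> (variety_A7 :: 'a zroupoid set) = variety_A8
    \<and> (variety_A8 :: 'a zroupoid set) = variety_A10"
  using variety_A3_subset_A5 variety_A3_subset_A8 variety_A5_subset_A10 variety_A10_subset_A7
    variety_A8_subset_A7 variety_A7_subset_A3
  by blast

end
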